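(* Let $(\mathfrak{K},\mu)$ be a normed category and let $F\colon\mathfrak{K}\to\mathfrak{K}$ be a contraction. Suppose $f\colon a\to F(a)$ is an arrow of $\mathfrak{K}$ such that $\mu(f)<+\infty$. Then the sequence $$a\xrightarrow{\;f\;}F(a)\xrightarrow{\;F(f)\;}F^2(a)\xrightarrow{\;F^2(f)\;}F^3(a)\xrightarrow{\;F^3(f)\;}\cdots$$ is a fixed-point of the extension $\overline{F}$ of $F$ defined on $\sigma(\mathfrak{K},\mu)$.
   Context: A norm on a category $\mathfrak{K}$ is a function $\mu$ from the arrows of $\mathfrak{K}$ to $[0,+\infty]$ such that: (N1) $\mu(\mathrm{id}_x)=0$ for every object $x$; (N2) $\mu(f\circ g)\le \mu(f)+\mu(g)$ whenever $f\circ g$ is defined; (N3) $\mu(g)\le \mu(f\circ g)+\mu(f)$ whenever $f\circ g$ is defined. A normed category is a pair $(\mathfrak{K},\mu)$ where $\mu$ is a norm on $\mathfrak{K}$. A $0$-isomorphism is an isomorphism of norm $0$. A contraction is a covariant functor $F$ satisfying $\mu(F(f))\le r\,\mu(f)$ for every arrow $f$, where $r<1$ is fixed and independent of $f$. A fixed-point of a functor $G$ from a normed category to itself is an object $X$ for which there exists a $0$-isomorphism $h\colon X\to G(X)$. A sequence in a category is a covariant functor $\vec{x}$ from $\omega$ (the natural numbers, as a poset category) to the category; $x_n$ is its $n$th object and $x_n^m\colon x_n\to x_m$ ($n\le m$) its bonding arrow. A sequence $\vec{x}$ in $(\mathfrak{K},\mu)$ is Cauchy if for every $\varepsilon>0$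 there is $n_0$ such that $\mu(x_m^n)<\varepsilon$ whenever $n_0<m\le n$. The normed category $\sigma(\mathfrak{K},\mu)$ has as objects all Cauchy sequences in $(\mathfrak{K},\mu)$. Its arrows from $\vec{x}$ to $\vec{y}$ are the transformations from $\vec{x}$ to $\vec{y}$: a transformation is a natural transformation from $\vec{x}$ to $\vec{y}\circ\varphi$, where $\varphi\colon\omega\to\omega$ is increasing (i.e. a self-functor on $\omega$); more precisely, it is a family of arrows $\vec{f}=(f_n)_{n\in\omega}$ with $f_n\colon x_n\to y_{\varphi(n)}$ for some increasing map $\varphi\colon\omega\to\omega$, satisfying $y_{\varphi(m)}^{\varphi(n)}\circ f_m=f_n\circ x_m^n$ for every $m<n<\omega$. Transformations are composed in the obvious way: $\vec{f}\colon\vec{x}\to\vec{y}$ (along $\varphi$) followed by $\vec{g}\colon\vec{y}\to\vec{z}$ (along $\psi$) is $(g_{\varphi(n)}\circ f_n)_{n\in\omega}$ (along $\psi\circ\varphi$). The norm on $\sigma(\mathfrak{K},\mu)$ is $\overline{\mu}(\vec{f})=\lim_{n\to\infty}\mu(f_n)$ (this limit exists for every transformation of Cauchy sequences). The category $\mathfrak{K}$ is identified with a subcategory of $\sigma(\mathfrak{K},\mu)$ by identifying each object $x$ with the constant sequence at $x$ whose bonding arrows are identities. The extension $\overline{F}\colon\sigma(\mathfrak{K},\mu)\to\sigma(\mathfrak{K},\mu)$ of $F$ is obtained by applying $F$ to sequences and transformations: $\overline{F}(\vec{x})=F\circ\vec{x}$ and $\overline{F}((f_n)_{n\in\omega})=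(F(f_n))_{n\in\omega}$.
   Formalization: Arrows of σ(K,μ) are classes of transformations along unbounded increasing φ, identified when they agree after composing with bonding arrows of the target; with transformations themselves as arrows the claim fails (K=ω, zero norm, F(n)=n+1, a=0). *)

theory Defs
  imports "HOL-Library.Extended_Nonnegative_Real" "HOL-Library.FuncSet"
begin

record ('o, 'a) cat =
  Obj :: "'o set"
  Arr :: "'a set"
  Dom :: "'a \<Rightarrow> 'o"
  Cod :: "'a \<Rightarrow> 'o"
  Ident :: "'o \<Rightarrow> 'a"
  Comp :: "'a \<Rightarrow> 'a \<Rightarrow> 'a"  (infixr "\<odot>\<index>" 70)

text \<open>\<^term>\<open>Comp C g f\<close> is \<open>g\<close> after \<open>f\<close>; it is meaningful only if \<^prop>\<open>Dom C g = Cod C f\<close>.\<close>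

definition hom :: "('o, 'a, 'z) cat_scheme \<Rightarrow> 'o \<Rightarrow> 'o \<Rightarrow> 'a set" where
  "hom C x y = {f \<in> Arr C. Dom C f = x \<and> Cod C f = y}"

locale category =
  fixes C :: "('o, 'a, 'z) cat_scheme" (structure)
  assumes Dom_in_Obj: "f \<in> Arr C \<Longrightarrow> Dom C f \<in> Obj C"
    and Cod_in_Obj: "f \<in> Arr C \<Longrightarrow> Cod C f \<in> Obj C"
    and Ident_in_hom: "x \<in> Obj C \<Longrightarrow> Ident C x \<in> hom C x x"
    and Comp_in_hom: "f \<in> hom C x y \<Longrightarrow> g \<in> hom C y z \<Longrightarrow> g \<odot> f \<in> hom C x z"
    and Comp_Ident_left: "f \<in> hom C x y \<Longrightarrow> Ident C y \<odot> f = f"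
    and Comp_Ident_right: "f \<in> hom C x y \<Longrightarrow> f \<odot> Ident C x = f"
    and Comp_assoc: "f \<in> hom C w x \<Longrightarrow> g \<in> hom C x y \<Longrightarrow> h \<in> hom C y z \<Longrightarrow>
      (h \<odot> g) \<odot> f = h \<odot> (g \<odot> f)"

record ('o, 'a, 'p, 'b) func =
  omap :: "'o \<Rightarrow> 'p"
  amap :: "'a \<Rightarrow> 'b"

locale cat_functor = C: category C + D: category D
  for C :: "('o, 'a, 'y) cat_scheme" and D :: "('p, 'b, 'z) cat_scheme" +
  fixes F :: "('o, 'a, 'p, 'b) func"
  assumes omap_in_Obj: "x \<in> Obj C \<Longrightarrow> omap F x \<in> Obj D"
    and amap_in_hom: "f \<in> hom C x y \<Longrightarrow> amap F f \<in> hom D (omap F x) (omap F y)"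
    and amap_Ident: "x \<in> Obj C \<Longrightarrow> amap F (Ident C x) = Ident D (omap F x)"
    and amap_Comp: "f \<in> hom C x y \<Longrightarrow> g \<in> hom C y z \<Longrightarrow>
      amap F (g \<odot>\<^bsub>C\<^esub> f) = amap F g \<odot>\<^bsub>D\<^esub> amap F f"

locale normed_category = category +
  fixes \<mu> :: "'a \<Rightarrow> ennreal"
  assumes N1: "x \<in> Obj C \<Longrightarrow> \<mu> (Ident C x) = 0"
    and N2: "g \<in> hom C x y \<Longrightarrow> f \<in> hom C y z \<Longrightarrow> \<mu> (f \<odot> g) \<le> \<mu> f + \<mu> g"
    and N3: "g \<in> hom C x y \<Longrightarrow> f \<in> hom C y z \<Longrightarrow> \<mu> g \<le> \<mu> (f \<odot> g) + \<mu> f"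

text \<open>The constant \<open>r\<close> may be \<open>0\<close>, where \<open>0 * \<infinity> = 0\<close>; this convention is immaterial, since
  a functor that satisfies the condition for \<open>r = 0\<close> also satisfies it for every \<open>r < 1\<close>.\<close>

locale contraction = cat_functor C D F + C: normed_category C \<mu> + D: normed_category D \<nu>
  for C :: "('o, 'a, 'y) cat_scheme" and \<mu> :: "'a \<Rightarrow> ennreal"
    and D :: "('p, 'b, 'z) cat_scheme" and \<nu> :: "'b \<Rightarrow> ennreal"
    and F :: "('o, 'a, 'p, 'b) func" +
  assumes contracts: "\<exists>r<1. \<forall>f\<in>Arr C. \<nu> (amap F f) \<le> r * \<mu> f"

definition isomorphism :: "('o, 'a, 'z) cat_scheme \<Rightarrow> 'a \<Rightarrow> bool" where
  "isomorphism C h \<longleftrightarrow> h \<in> Arr C \<and>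
     (\<exists>g \<in> hom C (Cod C h) (Dom C h).
        g \<odot>\<^bsub>C\<^esub> h = Ident C (Dom C h) \<and> h \<odot>\<^bsub>C\<^esub> g = Ident C (Cod C h))"

definition zero_isomorphism :: "('o, 'a, 'z) cat_scheme \<Rightarrow> ('a \<Rightarrow> ennreal) \<Rightarrow> 'a \<Rightarrow> bool" where
  "zero_isomorphism C \<mu> h \<longleftrightarrow> isomorphism C h \<and> \<mu> h = 0"

definition fixed_point ::
  "('o, 'a, 'z) cat_scheme \<Rightarrow> ('a \<Rightarrow> ennreal) \<Rightarrow> ('o, 'a, 'o, 'a) func \<Rightarrow> 'o \<Rightarrow> bool" where
  "fixed_point C \<mu> G X \<longleftrightarrow>
     X \<in> Obj C \<and> (\<exists>h \<in> hom C X (omap G X). zero_isomorphism C \<mu> h)"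

text \<open>The poset category of the natural numbers: the pair \<open>(m, n)\<close> with \<open>m \<le> n\<close> is the unique
  arrow from \<open>m\<close> to \<open>n\<close>.\<close>

definition omega :: "(nat, nat \<times> nat) cat" where
  "omega = \<lparr>Obj = UNIV, Arr = {(m, n). m \<le> n}, Dom = fst, Cod = snd,
            Ident = (\<lambda>n. (n, n)), Comp = (\<lambda>q p. (fst p, snd q))\<rparr>"

type_synonym ('o, 'a) seqn = "(nat, nat \<times> nat, 'o, 'a) func"

text \<open>Extensionality makes two sequences with the same objects and bonding arrows equal.\<close>

definition sequences :: "('o, 'a, 'z) cat_scheme \<Rightarrow> ('o, 'a) seqn set" where
  "sequences C = {x. cat_functor omega C x \<and> amap x \<in> extensional (Arr omega)}"

abbreviation bond :: "('o, 'a) seqn \<Rightarrow> nat \<Rightarrow> nat \<Rightarrow> 'a" where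
  "bond x m n \<equiv> amap x (m, n)"

definition Cauchy_sequences :: "('o, 'a, 'z) cat_scheme \<Rightarrow> ('a \<Rightarrow> ennreal) \<Rightarrow> ('o, 'a) seqn set" where
  "Cauchy_sequences C \<mu> = {x \<in> sequences C.
     \<forall>e>0. \<exists>n0. \<forall>m n. n0 < m \<and> m \<le> n \<longrightarrow> \<mu> (bond x m n) < ennreal e}"

text \<open>A transformation is kept together with its index map \<open>\<phi>\<close>, because composition depends
  on it. Increasing means monotone; \<open>\<phi>\<close> is moreover required to be unbounded, without which the
  limit norm would not be invariant under the identification of transformations below.\<close>

definition transformations ::
  "('o, 'a, 'z) cat_scheme \<Rightarrow> ('o, 'a) seqn \<Rightarrow> ('o, 'a) seqn \<Rightarrow> ((nat \<Rightarrow> nat) \<times> (nat \<Rightarrow> 'a)) set" where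
  "transformations C x y = {(\<phi>, f).
     mono \<phi> \<and> filterlim \<phi> at_top sequentially \<and>
     (\<forall>n. f n \<in> hom C (omap x n) (omap y (\<phi> n))) \<and>
     (\<forall>m n. m < n \<longrightarrow> bond y (\<phi> m) (\<phi> n) \<odot>\<^bsub>C\<^esub> f m = f n \<odot>\<^bsub>C\<^esub> bond x m n)}"

text \<open>Two transformations are identified when they agree after composition with bonding arrows
  of the target (equality of arrows of ind-objects). Without this identification only levelwise
  isomorphic sequences would be isomorphic; in particular a sequence would not be isomorphic
  to its own tail.\<close>

definition trans_equiv ::
  "('o, 'a, 'z) cat_scheme \<Rightarrow> ('o, 'a) seqn \<Rightarrow> ('o, 'a) seqn \<Rightarrow>
     ((nat \<Rightarrow> nat) \<times> (nat \<Rightarrow> 'a)) rel" where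
  "trans_equiv C x y = {((\<phi>, f), (\<psi>, g)).
     (\<phi>, f) \<in> transformations C x y \<and> (\<psi>, g) \<in> transformations C x y \<and>
     (\<forall>n. \<exists>k. \<phi> n \<le> k \<and> \<psi> n \<le> k \<and>
        bond y (\<phi> n) k \<odot>\<^bsub>C\<^esub> f n = bond y (\<psi> n) k \<odot>\<^bsub>C\<^esub> g n)}"

text \<open>An arrow is a triple of source, target and equivalence class of transformations.\<close>

type_synonym ('o, 'a) sigma_arr =
  "('o, 'a) seqn \<times> ('o, 'a) seqn \<times> ((nat \<Rightarrow> nat) \<times> (nat \<Rightarrow> 'a)) set"

definition sigma ::
  "('o, 'a, 'z) cat_scheme \<Rightarrow> ('a \<Rightarrow> ennreal) \<Rightarrow> (('o, 'a) seqn, ('o, 'a) sigma_arr) cat" where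
  "sigma C \<mu> = \<lparr>
     Obj = Cauchy_sequences C \<mu>,
     Arr = {(x, y, A). x \<in> Cauchy_sequences C \<mu> \<and> y \<in> Cauchy_sequences C \<mu> \<and>
              A \<in> transformations C x y // trans_equiv C x y},
     Dom = (\<lambda>(x, y, A). x),
     Cod = (\<lambda>(x, y, A). y),
     Ident = (\<lambda>x. (x, x, trans_equiv C x x `` {(\<lambda>n. n, \<lambda>n. Ident C (omap x n))})),
     Comp = (\<lambda>(y', z, B) (x, y, A). (x, z,
              \<Union>(\<phi>, f)\<in>A. \<Union>(\<psi>, g)\<in>B.
                trans_equiv C x z `` {(\<lambda>n. \<psi> (\<phi> n), \<lambda>n. g (\<phi> n) \<odot>\<^bsub>C\<^esub> f n)}))\<rparr>"

definition sigma_norm :: "('a \<Rightarrow> ennreal) \<Rightarrow> ('o, 'a) sigma_arr \<Rightarrow> ennreal" where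
  "sigma_norm \<mu> = (\<lambda>(x, y, A). THE r. \<forall>(\<phi>, f)\<in>A. (\<lambda>n. \<mu> (f n)) \<longlonglongrightarrow> r)"

definition seq_map :: "('o, 'a, 'p, 'b) func \<Rightarrow> ('o, 'a) seqn \<Rightarrow> ('p, 'b) seqn" where
  "seq_map F x = \<lparr>omap = (\<lambda>n. omap F (omap x n)),
                  amap = restrict (\<lambda>p. amap F (amap x p)) (Arr omega)\<rparr>"

definition extension ::
  "('o, 'a, 'z) cat_scheme \<Rightarrow> ('o, 'a, 'o, 'a) func \<Rightarrow>
     (('o, 'a) seqn, ('o, 'a) sigma_arr, ('o, 'a) seqn, ('o, 'a) sigma_arr) func" where
  "extension C F = \<lparr>
     omap = seq_map F,
     amap = (\<lambda>(x, y, A). (seq_map F x, seq_map F y,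
               \<Union>(\<phi>, f)\<in>A. trans_equiv C (seq_map F x) (seq_map F y) `` {(\<phi>, \<lambda>n. amap F (f n))}))\<rparr>"

text \<open>\<open>chain C s x m k\<close> is the composite \<open>s (m + k - 1) \<circ> \<dots> \<circ> s m\<close> of \<open>k\<close> consecutive
  arrows, where \<open>s n\<close> is an arrow from \<open>x n\<close> to \<open>x (n + 1)\<close>.\<close>

primrec chain ::
  "('o, 'a, 'z) cat_scheme \<Rightarrow> (nat \<Rightarrow> 'o) \<Rightarrow> (nat \<Rightarrow> 'a) \<Rightarrow> nat \<Rightarrow> nat \<Rightarrow> 'a" where
  "chain C x s m 0 = Ident C (x m)"
| "chain C x s m (Suc k) = s (m + k) \<odot>\<^bsub>C\<^esub> chain C x s m k"

definition orbit ::
  "('o, 'a, 'z) cat_scheme \<Rightarrow> ('o, 'a, 'o, 'a) func \<Rightarrow> 'o \<Rightarrow> 'a \<Rightarrow> ('o, 'a) seqn" where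
  "orbit C F a f = \<lparr>omap = (\<lambda>n. (omap F ^^ n) a),
     amap = restrict
       (\<lambda>(m, n). chain C (\<lambda>i. (omap F ^^ i) a) (\<lambda>i. (amap F ^^ i) f) m (n - m)) (Arr omega)\<rparr>"

text \<open>The facts below show that the construction is well defined: the limits defining
  \<^const>\<open>sigma_norm\<close> exist and depend only on the equivalence class, \<^const>\<open>sigma\<close> is a
  normed category, and the extension of a contraction is a functor.\<close>

lemma category_omega: "category omega"
  by unfold_locales (auto simp: omega_def hom_def)

lemma hom_omega: "p \<in> hom omega m n \<longleftrightarrow> p = (m, n) \<and> m \<le> n"
  by (cases p) (auto simp: omega_def hom_def)

lemma Arr_omega: "p \<in> Arr omega \<longleftrightarrow> fst p \<le> snd p"
  by (cases p) (auto simp: omega_def)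

lemma Obj_omega: "n \<in> Obj omega"
  by (auto simp: omega_def)

lemma Ident_omega: "Ident omega n = (n, n)"
  by (auto simp: omega_def)

lemma Comp_omega: "(m, n) \<odot>\<^bsub>omega\<^esub> (k, l) = (k, n)"
  by (auto simp: omega_def)

lemma sequences_iff:
  assumes "category C"
  shows "x \<in> sequences C \<longleftrightarrow> amap x \<in> extensional (Arr omega) \<and>
    (\<forall>n. omap x n \<in> Obj C) \<and>
    (\<forall>m n. m \<le> n \<longrightarrow> bond x m n \<in> hom C (omap x m) (omap x n)) \<and>
    (\<forall>n. bond x n n = Ident C (omap x n)) \<and>
    (\<forall>l m n. l \<le> m \<longrightarrow> m \<le> n \<longrightarrow> bond x m n \<odot>\<^bsub>C\<^esub> bond x l m = bond x l n)"
proof -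
  have "cat_functor_axioms omega C x \<longleftrightarrow> (\<forall>n. omap x n \<in> Obj C) \<and>
    (\<forall>m n. m \<le> n \<longrightarrow> bond x m n \<in> hom C (omap x m) (omap x n)) \<and>
    (\<forall>n. bond x n n = Ident C (omap x n)) \<and>
    (\<forall>l m n. l \<le> m \<longrightarrow> m \<le> n \<longrightarrow> bond x m n \<odot>\<^bsub>C\<^esub> bond x l m = bond x l n)"
    (is "?l \<longleftrightarrow> ?r")
  proof
    assume ?l
    then show ?r unfolding cat_functor_axioms_def hom_omega
      by (metis Obj_omega Ident_omega Comp_omega)
  next
    assume ?r
    then show ?l unfolding cat_functor_axioms_def hom_omega
      by (simp add: Ident_omega Comp_omega)
  qed
  then show ?thesis
    using assms category_omega by (auto simp: sequences_def cat_functor_def)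
qed

context category
begin

lemma hom_Obj: "f \<in> hom C x y \<Longrightarrow> x \<in> Obj C" "f \<in> hom C x y \<Longrightarrow> y \<in> Obj C"
  using Dom_in_Obj Cod_in_Obj by (auto simp: hom_def)

lemma seq_Obj: "x \<in> sequences C \<Longrightarrow> omap x n \<in> Obj C"
  and bond_in_hom: "x \<in> sequences C \<Longrightarrow> m \<le> n \<Longrightarrow> bond x m n \<in> hom C (omap x m) (omap x n)"
  and bond_refl: "x \<in> sequences C \<Longrightarrow> bond x n n = Ident C (omap x n)"
  and bond_Comp: "x \<in> sequences C \<Longrightarrow> l \<le> m \<Longrightarrow> m \<le> n \<Longrightarrow> bond x m n \<odot> bond x l m = bond x l n"
  using sequences_iff[OF category_axioms, of x] by auto

lemma bond_assoc:
  assumes "x \<in> sequences C" "l \<le> m" "m \<le> n" "f \<in> hom C w (omap x l)"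
  shows "bond x m n \<odot> (bond x l m \<odot> f) = bond x l n \<odot> f"
  using Comp_assoc[OF assms(4) bond_in_hom[OF assms(1,2)] bond_in_hom[OF assms(1,3)]]
    bond_Comp[OF assms(1-3)] by simp

lemma transD:
  assumes "(\<phi>, f) \<in> transformations C x y"
  shows "mono \<phi>" "filterlim \<phi> at_top sequentially"
    "f n \<in> hom C (omap x n) (omap y (\<phi> n))"
  using assms by (auto simp: transformations_def)

lemma trans_nat:
  assumes "(\<phi>, f) \<in> transformations C x y" "x \<in> sequences C" "y \<in> sequences C" "m \<le> n"
  shows "bond y (\<phi> m) (\<phi> n) \<odot> f m = f n \<odot> bond x m n"
proof (cases "m = n")
  case True
  then show ?thesis
    using Comp_Ident_left[OF transD(3)[OF assms(1)]] Comp_Ident_right[OF transD(3)[OF assms(1)]]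
    by (simp add: bond_refl assms(2,3))
next
  case False
  then show ?thesis using assms(1,4) by (auto simp: transformations_def)
qed

lemma transformationsI:
  assumes "mono \<phi>" "filterlim \<phi> at_top sequentially"
    "\<And>n. f n \<in> hom C (omap x n) (omap y (\<phi> n))"
    "\<And>m n. m < n \<Longrightarrow> bond y (\<phi> m) (\<phi> n) \<odot> f m = f n \<odot> bond x m n"
  shows "(\<phi>, f) \<in> transformations C x y"
  using assms by (auto simp: transformations_def)

lemma trans_equiv_equiv:
  assumes x: "x \<in> sequences C" and y: "y \<in> sequences C"
  shows "equiv (transformations C x y) (trans_equiv C x y)"
proof (rule equivI)
  show "trans_equiv C x y \<subseteq> transformations C x y \<times> transformations C x y"
    by (auto simp: trans_equiv_def)
  show "refl_on (transformations C x y) (trans_equiv C x y)"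
    by (auto simp: refl_on_def trans_equiv_def)
  show "sym (trans_equiv C x y)"
    unfolding sym_def trans_equiv_def by fastforce
  show "trans (trans_equiv C x y)"
  proof (rule transI)
    fix s t u
    assume st: "(s, t) \<in> trans_equiv C x y" and tu: "(t, u) \<in> trans_equiv C x y"
    obtain \<phi> f \<psi> g \<chi> h where e: "s = (\<phi>, f)" "t = (\<psi>, g)" "u = (\<chi>, h)" by (metis surj_pair)
    note tr = st[unfolded trans_equiv_def e] tu[unfolded trans_equiv_def e]
    have fT: "(\<phi>, f) \<in> transformations C x y" and gT: "(\<psi>, g) \<in> transformations C x y"
      and hT: "(\<chi>, h) \<in> transformations C x y" using tr by auto
    have "\<exists>k. \<phi> n \<le> k \<and> \<chi> n \<le> k \<and> bond y (\<phi> n) k \<odot> f n = bond y (\<chi> n) k \<odot> h n" for n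
    proof -
      obtain k where k: "\<phi> n \<le> k" "\<psi> n \<le> k" "bond y (\<phi> n) k \<odot> f n = bond y (\<psi> n) k \<odot> g n"
        using tr by auto
      obtain l where l: "\<psi> n \<le> l" "\<chi> n \<le> l" "bond y (\<psi> n) l \<odot> g n = bond y (\<chi> n) l \<odot> h n"
        using tr by auto
      let ?m = "max k l"
      have "bond y (\<phi> n) ?m \<odot> f n = bond y k ?m \<odot> (bond y (\<phi> n) k \<odot> f n)"
        using bond_assoc[OF y k(1) _ transD(3)[OF fT], of ?m] by simp
      also have "\<dots> = bond y (\<psi> n) ?m \<odot> g n"
        using bond_assoc[OF y k(2) _ transD(3)[OF gT], of ?m] by (simp add: k)
      also have "\<dots> = bond y l ?m \<odot> (bond y (\<psi> n) l \<odot> g n)"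
        using bond_assoc[OF y l(1) _ transD(3)[OF gT], of ?m] by simp
      also have "\<dots> = bond y (\<chi> n) ?m \<odot> h n"
        using bond_assoc[OF y l(2) _ transD(3)[OF hT], of ?m] by (simp add: l)
      finally show ?thesis using k(1) l(2) by (intro exI[of _ ?m]) auto
    qed
    then show "(s, u) \<in> trans_equiv C x y" using fT hT by (auto simp: trans_equiv_def e)
  qed
qed

lemma trans_equivD:
  assumes "((\<phi>, f), (\<psi>, g)) \<in> trans_equiv C x y"
  shows "(\<phi>, f) \<in> transformations C x y" "(\<psi>, g) \<in> transformations C x y"
    "\<exists>k. \<phi> n \<le> k \<and> \<psi> n \<le> k \<and> bond y (\<phi> n) k \<odot> f n = bond y (\<psi> n) k \<odot> g n"
  using assms by (auto simp: trans_equiv_def)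

lemma trans_equivI:
  assumes "(\<phi>, f) \<in> transformations C x y" "(\<psi>, g) \<in> transformations C x y"
    "\<And>n. \<exists>k. \<phi> n \<le> k \<and> \<psi> n \<le> k \<and> bond y (\<phi> n) k \<odot> f n = bond y (\<psi> n) k \<odot> g n"
  shows "((\<phi>, f), (\<psi>, g)) \<in> trans_equiv C x y"
  using assms by (auto simp: trans_equiv_def)

definition tcomp :: "(nat \<Rightarrow> nat) \<times> (nat \<Rightarrow> 'a) \<Rightarrow> (nat \<Rightarrow> nat) \<times> (nat \<Rightarrow> 'a) \<Rightarrow> (nat \<Rightarrow> nat) \<times> (nat \<Rightarrow> 'a)" where
  "tcomp = (\<lambda>(\<psi>, g) (\<phi>, f). (\<lambda>n. \<psi> (\<phi> n), \<lambda>n. g (\<phi> n) \<odot> f n))"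

lemma tcomp_in:
  assumes x: "x \<in> sequences C" and y: "y \<in> sequences C" and z: "z \<in> sequences C"
    and s: "s \<in> transformations C x y" and t: "t \<in> transformations C y z"
  shows "tcomp t s \<in> transformations C x z"
proof -
  obtain \<phi> f \<psi> g where e: "s = (\<phi>, f)" "t = (\<psi>, g)" by (metis surj_pair)
  note s = s[unfolded e] note t = t[unfolded e]
  have mf: "\<phi> m \<le> \<phi> n" if "m \<le> n" for m n using transD(1)[OF s] that by (simp add: monoD)
  have mg: "\<psi> m \<le> \<psi> n" if "m \<le> n" for m n using transD(1)[OF t] that by (simp add: monoD)
  show ?thesis unfolding tcomp_def e split
  proof (rule transformationsI)
    show "mono (\<lambda>n. \<psi> (\<phi> n))" by (intro monoI mf mg)
    show "filterlim (\<lambda>n. \<psi> (\<phi> n)) at_top sequentially"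
      using filterlim_compose[OF transD(2)[OF t] transD(2)[OF s]] .
    show "g (\<phi> n) \<odot> f n \<in> hom C (omap x n) (omap z (\<psi> (\<phi> n)))" for n
      using Comp_in_hom[OF transD(3)[OF s] transD(3)[OF t]] .
    fix m n :: nat assume mn: "m < n"
    then have le: "\<phi> m \<le> \<phi> n" "\<psi> (\<phi> m) \<le> \<psi> (\<phi> n)" "m \<le> n" using mf mg by auto
    have "bond z (\<psi> (\<phi> m)) (\<psi> (\<phi> n)) \<odot> (g (\<phi> m) \<odot> f m) =
        (bond z (\<psi> (\<phi> m)) (\<psi> (\<phi> n)) \<odot> g (\<phi> m)) \<odot> f m"
      using Comp_assoc[OF transD(3)[OF s] transD(3)[OF t] bond_in_hom[OF z le(2)]] by simp
    also have "\<dots> = (g (\<phi> n) \<odot> bond y (\<phi> m) (\<phi> n)) \<odot> f m"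
      using trans_nat[OF t y z le(1)] by simp
    also have "\<dots> = g (\<phi> n) \<odot> (bond y (\<phi> m) (\<phi> n) \<odot> f m)"
      using Comp_assoc[OF transD(3)[OF s] bond_in_hom[OF y le(1)] transD(3)[OF t]] .
    also have "\<dots> = g (\<phi> n) \<odot> (f n \<odot> bond x m n)"
      using trans_nat[OF s x y le(3)] by simp
    also have "\<dots> = (g (\<phi> n) \<odot> f n) \<odot> bond x m n"
      using Comp_assoc[OF bond_in_hom[OF x le(3)] transD(3)[OF s] transD(3)[OF t]] by simp
    finally show "bond z (\<psi> (\<phi> m)) (\<psi> (\<phi> n)) \<odot> (g (\<phi> m) \<odot> f m) =
        (g (\<phi> n) \<odot> f n) \<odot> bond x m n" .
  qed
qed

lemma tcomp_equiv_left:
  assumes x: "x \<in> sequences C" and y: "y \<in> sequences C" and z: "z \<in> sequences C"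
    and s: "s \<in> transformations C x y" and t: "(t, t') \<in> trans_equiv C y z"
  shows "(tcomp t s, tcomp t' s) \<in> trans_equiv C x z"
proof -
  obtain \<phi> f \<psi> g \<psi>' g' where e: "s = (\<phi>, f)" "t = (\<psi>, g)" "t' = (\<psi>', g')" by (metis surj_pair)
  note s = s[unfolded e] note t = t[unfolded e]
  note T = trans_equivD(1)[OF t] note T' = trans_equivD(2)[OF t]
  show ?thesis unfolding e tcomp_def split
  proof (rule trans_equivI)
    show "(\<lambda>n. \<psi> (\<phi> n), \<lambda>n. g (\<phi> n) \<odot> f n) \<in> transformations C x z"
      "(\<lambda>n. \<psi>' (\<phi> n), \<lambda>n. g' (\<phi> n) \<odot> f n) \<in> transformations C x z"
      using tcomp_in[OF x y z s T] tcomp_in[OF x y z s T'] by (auto simp: tcomp_def)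
    fix n
    obtain k where k: "\<psi> (\<phi> n) \<le> k" "\<psi>' (\<phi> n) \<le> k"
      "bond z (\<psi> (\<phi> n)) k \<odot> g (\<phi> n) = bond z (\<psi>' (\<phi> n)) k \<odot> g' (\<phi> n)"
      using trans_equivD(3)[OF t] by blast
    have "bond z (\<psi> (\<phi> n)) k \<odot> (g (\<phi> n) \<odot> f n) = bond z (\<psi>' (\<phi> n)) k \<odot> (g' (\<phi> n) \<odot> f n)"
      using Comp_assoc[OF transD(3)[OF s] transD(3)[OF T] bond_in_hom[OF z k(1)]]
        Comp_assoc[OF transD(3)[OF s] transD(3)[OF T'] bond_in_hom[OF z k(2)]] k(3) by simp
    then show "\<exists>k. \<psi> (\<phi> n) \<le> k \<and> \<psi>' (\<phi> n) \<le> k \<and>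
      bond z (\<psi> (\<phi> n)) k \<odot> (g (\<phi> n) \<odot> f n) = bond z (\<psi>' (\<phi> n)) k \<odot> (g' (\<phi> n) \<odot> f n)"
      using k by blast
  qed
qed

lemma tcomp_equiv_right:
  assumes x: "x \<in> sequences C" and y: "y \<in> sequences C" and z: "z \<in> sequences C"
    and s: "(s, s') \<in> trans_equiv C x y" and t: "t \<in> transformations C y z"
  shows "(tcomp t s, tcomp t s') \<in> trans_equiv C x z"
proof -
  obtain \<phi> f \<phi>' f' \<psi> g where e: "s = (\<phi>, f)" "s' = (\<phi>', f')" "t = (\<psi>, g)" by (metis surj_pair)
  note s = s[unfolded e] note t = t[unfolded e]
  note S = trans_equivD(1)[OF s] note S' = trans_equivD(2)[OF s]
  show ?thesis unfolding e tcomp_def split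
  proof (rule trans_equivI)
    show "(\<lambda>n. \<psi> (\<phi> n), \<lambda>n. g (\<phi> n) \<odot> f n) \<in> transformations C x z"
      "(\<lambda>n. \<psi> (\<phi>' n), \<lambda>n. g (\<phi>' n) \<odot> f' n) \<in> transformations C x z"
      using tcomp_in[OF x y z S t] tcomp_in[OF x y z S' t] by (auto simp: tcomp_def)
    fix n
    obtain k where k: "\<phi> n \<le> k" "\<phi>' n \<le> k" "bond y (\<phi> n) k \<odot> f n = bond y (\<phi>' n) k \<odot> f' n"
      using trans_equivD(3)[OF s] by blast
    have le: "\<psi> (\<phi> n) \<le> \<psi> k" "\<psi> (\<phi>' n) \<le> \<psi> k" using k transD(1)[OF t] by (auto simp: monoD)
    have *: "bond z (\<psi> i) (\<psi> k) \<odot> (g i \<odot> h) = g k \<odot> (bond y i k \<odot> h)"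
      if "i \<le> k" "\<psi> i \<le> \<psi> k" "h \<in> hom C (omap x n) (omap y i)" for i h
      using Comp_assoc[OF that(3) transD(3)[OF t] bond_in_hom[OF z that(2)]]
        Comp_assoc[OF that(3) bond_in_hom[OF y that(1)] transD(3)[OF t]]
        trans_nat[OF t y z that(1)] by simp
    show "\<exists>k. \<psi> (\<phi> n) \<le> k \<and> \<psi> (\<phi>' n) \<le> k \<and>
      bond z (\<psi> (\<phi> n)) k \<odot> (g (\<phi> n) \<odot> f n) = bond z (\<psi> (\<phi>' n)) k \<odot> (g (\<phi>' n) \<odot> f' n)"
      using le *[OF k(1) le(1) transD(3)[OF S]] *[OF k(2) le(2) transD(3)[OF S']] k(3)
      by (intro exI[of _ "\<psi> k"]) simp
  qed
qed

lemma ident_in: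
  assumes x: "x \<in> sequences C"
  shows "(\<lambda>n. n, \<lambda>n. Ident C (omap x n)) \<in> transformations C x x"
proof (rule transformationsI)
  fix m n :: nat assume "m < n"
  then have "bond x m n \<in> hom C (omap x m) (omap x n)" using bond_in_hom[OF x] by simp
  then show "bond x m n \<odot> Ident C (omap x m) = Ident C (omap x n) \<odot> bond x m n"
    by (simp add: Comp_Ident_left Comp_Ident_right)
qed (auto simp: mono_def filterlim_ident intro: Ident_in_hom seq_Obj[OF x])

end

context normed_category
begin

lemma mu_sandwich:
  assumes "g \<in> hom C x y" "f \<in> hom C y z"
  shows "\<mu> g \<le> \<mu> (f \<odot> g) + \<mu> f" "\<mu> (f \<odot> g) \<le> \<mu> g + \<mu> f"
  using N2[OF assms] N3[OF assms] by (auto simp: add.commute)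

lemma Cauchy_seq: "x \<in> Cauchy_sequences C \<mu> \<Longrightarrow> x \<in> sequences C"
  by (simp add: Cauchy_sequences_def)

lemma CauchyE:
  assumes "x \<in> Cauchy_sequences C \<mu>" "e > 0"
  obtains n0 where "\<And>m n. n0 \<le> m \<Longrightarrow> m \<le> n \<Longrightarrow> \<mu> (bond x m n) < ennreal e"
proof -
  obtain n0 where "\<And>m n. n0 < m \<Longrightarrow> m \<le> n \<Longrightarrow> \<mu> (bond x m n) < ennreal e"
    using assms unfolding Cauchy_sequences_def by blast
  then show ?thesis by (intro that[of "Suc n0"]) auto
qed

lemma ennreal_limit_of_almost_increasing:
  fixes a :: "nat \<Rightarrow> ennreal"
  assumes "\<And>e::real. e > 0 \<Longrightarrow> \<exists>n0. \<forall>m n. n0 \<le> m \<longrightarrow> m \<le> n \<longrightarrow> a m \<le> a n + ennreal e"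
  shows "convergent a"
proof -
  have "limsup a \<le> liminf a"
  proof (rule ennreal_le_epsilon)
    fix e :: real assume "e > 0"
    then obtain n0 where n0: "\<And>m n. n0 \<le> m \<Longrightarrow> m \<le> n \<Longrightarrow> a m \<le> a n + ennreal e"
      using assms by blast
    have *: "a m \<le> liminf a + ennreal e" if "n0 \<le> m" for m
    proof -
      have "a m - ennreal e \<le> a n" if "m \<le> n" for n
        using n0[OF \<open>n0 \<le> m\<close> that] by (simp add: ennreal_minus_le_iff add.commute)
      then have "a m - ennreal e \<le> liminf a"
        by (intro Liminf_bounded) (auto simp: eventually_sequentially)
      then show ?thesis
        by (simp add: ennreal_minus_le_iff add.commute)
    qed
    show "limsup a \<le> liminf a + ennreal e"
      by (rule Limsup_bounded) (use * in \<open>auto simp: eventually_sequentially\<close>)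
  qed
  then have "a \<longlonglongrightarrow> liminf a"
    by (simp add: tendsto_iff_Liminf_eq_Limsup antisym Liminf_le_Limsup)
  then show ?thesis by (auto simp: convergent_def)
qed


lemma norm_convergent:
  assumes t: "(\<phi>, f) \<in> transformations C x y"
    and x: "x \<in> Cauchy_sequences C \<mu>" and y: "y \<in> Cauchy_sequences C \<mu>"
  shows "convergent (\<lambda>n. \<mu> (f n))"
proof (rule ennreal_limit_of_almost_increasing)
  fix e :: real assume "e > 0"
  then have e: "e / 2 > 0" by simp
  obtain n1 where n1: "\<And>m n. n1 \<le> m \<Longrightarrow> m \<le> n \<Longrightarrow> \<mu> (bond x m n) < ennreal (e/2)"
    using CauchyE[OF x e] by blast
  obtain n2 where n2: "\<And>m n. n2 \<le> m \<Longrightarrow> m \<le> n \<Longrightarrow> \<mu> (bond y m n) < ennreal (e/2)"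
    using CauchyE[OF y e] by blast
  obtain n3 where n3: "\<And>n. n3 \<le> n \<Longrightarrow> n2 \<le> \<phi> n"
    using transD(2)[OF t] by (auto simp: filterlim_at_top eventually_sequentially)
  have "\<mu> (f m) \<le> \<mu> (f n) + ennreal e" if m: "max n1 n3 \<le> m" and mn: "m \<le> n" for m n
  proof -
    have le: "\<phi> m \<le> \<phi> n" using transD(1)[OF t] mn by (simp add: monoD)
    have "\<mu> (f m) \<le> \<mu> (bond y (\<phi> m) (\<phi> n) \<odot> f m) + \<mu> (bond y (\<phi> m) (\<phi> n))"
      using mu_sandwich(1)[OF transD(3)[OF t] bond_in_hom[OF Cauchy_seq[OF y] le]] .
    also have "\<dots> = \<mu> (f n \<odot> bond x m n) + \<mu> (bond y (\<phi> m) (\<phi> n))"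
      using trans_nat[OF t Cauchy_seq[OF x] Cauchy_seq[OF y] mn] by simp
    also have "\<dots> \<le> (\<mu> (bond x m n) + \<mu> (f n)) + \<mu> (bond y (\<phi> m) (\<phi> n))"
      using mu_sandwich(2)[OF bond_in_hom[OF Cauchy_seq[OF x] mn] transD(3)[OF t]]
      by (rule add_right_mono)
    also have "\<dots> \<le> (ennreal (e/2) + \<mu> (f n)) + ennreal (e/2)"
      using n1[of m n] n2[of "\<phi> m" "\<phi> n"] n3[of m] m mn le by (intro add_mono) auto
    also have "\<dots> = \<mu> (f n) + (ennreal (e/2) + ennreal (e/2))"
      by (simp add: ac_simps)
    also have "\<dots> = \<mu> (f n) + ennreal e"
      using e by (subst ennreal_plus[symmetric]) auto
    finally show ?thesis .
  qed
  then show "\<exists>n0. \<forall>m n. n0 \<le> m \<longrightarrow> m \<le> n \<longrightarrow> \<mu> (f m) \<le> \<mu> (f n) + ennreal e" by blast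
qed

lemma norm_equiv_le:
  assumes t: "((\<phi>, f), (\<psi>, g)) \<in> trans_equiv C x y" and y: "y \<in> Cauchy_sequences C \<mu>"
    and f: "(\<lambda>n. \<mu> (f n)) \<longlonglongrightarrow> L" and g: "(\<lambda>n. \<mu> (g n)) \<longlonglongrightarrow> M"
  shows "L \<le> M"
proof (rule ennreal_le_epsilon)
  fix e :: real assume "e > 0"
  then have e: "e / 2 > 0" by simp
  note F = trans_equivD(1)[OF t] and G = trans_equivD(2)[OF t]
  obtain n2 where n2: "\<And>m n. n2 \<le> m \<Longrightarrow> m \<le> n \<Longrightarrow> \<mu> (bond y m n) < ennreal (e/2)"
    using CauchyE[OF y e] by blast
  have "eventually (\<lambda>n. n2 \<le> \<phi> n) sequentially" "eventually (\<lambda>n. n2 \<le> \<psi> n) sequentially"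
    using transD(2)[OF F] transD(2)[OF G] by (auto simp: filterlim_at_top)
  then have "eventually (\<lambda>n. \<mu> (f n) \<le> \<mu> (g n) + ennreal e) sequentially"
  proof eventually_elim
    case (elim n)
    obtain k where k: "\<phi> n \<le> k" "\<psi> n \<le> k" "bond y (\<phi> n) k \<odot> f n = bond y (\<psi> n) k \<odot> g n"
      using trans_equivD(3)[OF t] by blast
    have "\<mu> (f n) \<le> \<mu> (bond y (\<phi> n) k \<odot> f n) + \<mu> (bond y (\<phi> n) k)"
      using mu_sandwich(1)[OF transD(3)[OF F] bond_in_hom[OF Cauchy_seq[OF y] k(1)]] .
    also have "\<dots> \<le> (\<mu> (g n) + \<mu> (bond y (\<psi> n) k)) + \<mu> (bond y (\<phi> n) k)"
      unfolding k(3)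
      using mu_sandwich(2)[OF transD(3)[OF G] bond_in_hom[OF Cauchy_seq[OF y] k(2)]]
      by (rule add_right_mono)
    also have "\<dots> \<le> (\<mu> (g n) + ennreal (e/2)) + ennreal (e/2)"
      using n2[of "\<phi> n" k] n2[of "\<psi> n" k] elim k by (intro add_mono) auto
    also have "\<dots> = \<mu> (g n) + (ennreal (e/2) + ennreal (e/2))"
      by (simp add: ac_simps)
    also have "\<dots> = \<mu> (g n) + ennreal e"
      using e by (subst ennreal_plus[symmetric]) auto
    finally show ?case .
  qed
  then show "L \<le> M + ennreal e"
    by (intro tendsto_le[OF _ tendsto_add[OF g tendsto_const] f]) auto
qed

lemma norm_equiv_eq:
  assumes t: "((\<phi>, f), (\<psi>, g)) \<in> trans_equiv C x y"
    and x: "x \<in> Cauchy_sequences C \<mu>" and y: "y \<in> Cauchy_sequences C \<mu>"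
    and f: "(\<lambda>n. \<mu> (f n)) \<longlonglongrightarrow> L"
  shows "(\<lambda>n. \<mu> (g n)) \<longlonglongrightarrow> L"
proof -
  obtain M where M: "(\<lambda>n. \<mu> (g n)) \<longlonglongrightarrow> M"
    using norm_convergent[OF trans_equivD(2)[OF t] x y] by (auto simp: convergent_def)
  have t': "((\<psi>, g), (\<phi>, f)) \<in> trans_equiv C x y"
    using trans_equiv_equiv[OF Cauchy_seq[OF x] Cauchy_seq[OF y]] t by (meson equivE symD)
  show ?thesis
    using norm_equiv_le[OF t y f M] norm_equiv_le[OF t' y M f] M by simp
qed

lemma sigma_norm_limit:
  assumes t: "(\<phi>, f) \<in> transformations C x y"
    and x: "x \<in> Cauchy_sequences C \<mu>" and y: "y \<in> Cauchy_sequences C \<mu>"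
  shows "(\<lambda>n. \<mu> (f n)) \<longlonglongrightarrow> sigma_norm \<mu> (x, y, trans_equiv C x y `` {(\<phi>, f)})"
proof -
  obtain L where L: "(\<lambda>n. \<mu> (f n)) \<longlonglongrightarrow> L"
    using norm_convergent[OF t x y] by (auto simp: convergent_def)
  have "sigma_norm \<mu> (x, y, trans_equiv C x y `` {(\<phi>, f)}) = L"
    unfolding sigma_norm_def split
  proof (rule the_equality)
    show "\<forall>(\<psi>, g)\<in>trans_equiv C x y `` {(\<phi>, f)}. (\<lambda>n. \<mu> (g n)) \<longlonglongrightarrow> L"
      using norm_equiv_eq[OF _ x y L] by auto
    fix r assume *: "\<forall>(\<psi>, g)\<in>trans_equiv C x y `` {(\<phi>, f)}. (\<lambda>n. \<mu> (g n)) \<longlonglongrightarrow> r"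
    have "(\<phi>, f) \<in> trans_equiv C x y `` {(\<phi>, f)}"
      using equiv_class_self[OF trans_equiv_equiv[OF Cauchy_seq[OF x] Cauchy_seq[OF y]] t] .
    with * have "(\<lambda>n. \<mu> (f n)) \<longlonglongrightarrow> r" by auto
    then show "r = L" using L LIMSEQ_unique by blast
  qed
  with L show ?thesis by simp
qed

lemma sigma_simps:
  "Obj (sigma C \<mu>) = Cauchy_sequences C \<mu>"
  "Dom (sigma C \<mu>) (x, y, A) = x" "Cod (sigma C \<mu>) (x, y, A) = y"
  "Ident (sigma C \<mu>) x = (x, x, trans_equiv C x x `` {(\<lambda>n. n, \<lambda>n. Ident C (omap x n))})"
  "(x, y, A) \<in> Arr (sigma C \<mu>) \<longleftrightarrow> x \<in> Cauchy_sequences C \<mu> \<and> y \<in> Cauchy_sequences C \<mu> \<and>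
     A \<in> transformations C x y // trans_equiv C x y"
  by (auto simp: sigma_def)

lemma sigma_homE:
  assumes "h \<in> hom (sigma C \<mu>) x y"
  obtains t where "h = (x, y, trans_equiv C x y `` {t})" "t \<in> transformations C x y"
    "x \<in> Cauchy_sequences C \<mu>" "y \<in> Cauchy_sequences C \<mu>"
proof -
  obtain x' y' A where h: "h = (x', y', A)" by (metis surj_pair)
  show ?thesis
    using assms that unfolding hom_def h by (auto simp: sigma_simps elim!: quotientE)
qed

lemma sigma_homI:
  assumes "t \<in> transformations C x y" "x \<in> Cauchy_sequences C \<mu>" "y \<in> Cauchy_sequences C \<mu>"
  shows "(x, y, trans_equiv C x y `` {t}) \<in> hom (sigma C \<mu>) x y"
  using assms by (auto simp: hom_def sigma_simps intro: quotientI)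

lemma sigma_Comp:
  assumes x: "x \<in> Cauchy_sequences C \<mu>" and y: "y \<in> Cauchy_sequences C \<mu>"
    and z: "z \<in> Cauchy_sequences C \<mu>"
    and s: "s \<in> transformations C x y" and t: "t \<in> transformations C y z"
  shows "Comp (sigma C \<mu>) (y, z, trans_equiv C y z `` {t}) (x, y, trans_equiv C x y `` {s}) =
    (x, z, trans_equiv C x z `` {tcomp t s})"
proof -
  note X = Cauchy_seq[OF x] and Y = Cauchy_seq[OF y] and Z = Cauchy_seq[OF z]
  let ?h = "\<lambda>s t. trans_equiv C x z `` {tcomp t s}"
  have "congruent2 (trans_equiv C x y) (trans_equiv C y z) ?h"
  proof (rule congruent2I[OF trans_equiv_equiv[OF X Y] trans_equiv_equiv[OF Y Z]])
    fix s1 s2 t assume "(s1, s2) \<in> trans_equiv C x y" "t \<in> transformations C y z"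
    then show "?h s1 t = ?h s2 t"
      using equiv_class_eq[OF trans_equiv_equiv[OF X Z] tcomp_equiv_right[OF X Y Z]] by blast
  next
    fix t1 t2 s assume "(t1, t2) \<in> trans_equiv C y z" "s \<in> transformations C x y"
    then show "?h s t1 = ?h s t2"
      using equiv_class_eq[OF trans_equiv_equiv[OF X Z] tcomp_equiv_left[OF X Y Z]] by blast
  qed
  then have "(\<Union>s'\<in>trans_equiv C x y `` {s}. \<Union>t'\<in>trans_equiv C y z `` {t}. ?h s' t') = ?h s t"
    using UN_equiv_class2[OF trans_equiv_equiv[OF X Y] trans_equiv_equiv[OF Y Z] _ s t] by blast
  then show ?thesis
    by (simp add: sigma_def tcomp_def split_beta)
qed

lemma tcomp_assoc:
  assumes "s \<in> transformations C w x" "t \<in> transformations C x y" "u \<in> transformations C y z"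
  shows "tcomp (tcomp u t) s = tcomp u (tcomp t s)"
proof -
  obtain \<phi> f \<psi> g \<chi> h where e: "s = (\<phi>, f)" "t = (\<psi>, g)" "u = (\<chi>, h)" by (metis surj_pair)
  note A = assms[unfolded e]
  show ?thesis
    using Comp_assoc[OF transD(3)[OF A(1)] transD(3)[OF A(2)] transD(3)[OF A(3)]]
    by (simp add: e tcomp_def)
qed

lemma tcomp_ident:
  assumes "t \<in> transformations C x y"
  shows "tcomp t (\<lambda>n. n, \<lambda>n. Ident C (omap x n)) = t"
    "tcomp (\<lambda>n. n, \<lambda>n. Ident C (omap y n)) t = t"
proof -
  obtain \<phi> f where e: "t = (\<phi>, f)" by (metis surj_pair)
  note A = assms[unfolded e]
  show "tcomp t (\<lambda>n. n, \<lambda>n. Ident C (omap x n)) = t"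
    "tcomp (\<lambda>n. n, \<lambda>n. Ident C (omap y n)) t = t"
    using Comp_Ident_left[OF transD(3)[OF A]] Comp_Ident_right[OF transD(3)[OF A]]
    by (simp_all add: e tcomp_def)
qed

lemma category_sigma: "category (sigma C \<mu>)"
proof
  fix h assume "h \<in> Arr (sigma C \<mu>)"
  then show "Dom (sigma C \<mu>) h \<in> Obj (sigma C \<mu>)" "Cod (sigma C \<mu>) h \<in> Obj (sigma C \<mu>)"
    by (cases h; auto simp: sigma_simps)+
next
  fix x assume "x \<in> Obj (sigma C \<mu>)"
  then show "Ident (sigma C \<mu>) x \<in> hom (sigma C \<mu>) x x"
    by (auto simp: sigma_simps intro!: sigma_homI ident_in Cauchy_seq)
next
  fix f g x y z assume f: "f \<in> hom (sigma C \<mu>) x y" and g: "g \<in> hom (sigma C \<mu>) y z"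
  show "Comp (sigma C \<mu>) g f \<in> hom (sigma C \<mu>) x z"
    using f g by (auto elim!: sigma_homE simp: sigma_Comp intro!: sigma_homI tcomp_in Cauchy_seq)
next
  fix f x y assume f: "f \<in> hom (sigma C \<mu>) x y"
  show "Comp (sigma C \<mu>) (Ident (sigma C \<mu>) y) f = f"
    using f by (elim sigma_homE)
      (simp add: sigma_simps sigma_Comp ident_in Cauchy_seq tcomp_ident)
  show "Comp (sigma C \<mu>) f (Ident (sigma C \<mu>) x) = f"
    using f by (elim sigma_homE)
      (simp add: sigma_simps sigma_Comp ident_in Cauchy_seq tcomp_ident)
next
  fix f g h w x y z
  assume f: "f \<in> hom (sigma C \<mu>) w x" and g: "g \<in> hom (sigma C \<mu>) x y"
    and h: "h \<in> hom (sigma C \<mu>) y z"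
  obtain s t u where "f = (w, x, trans_equiv C w x `` {s})" "g = (x, y, trans_equiv C x y `` {t})"
    "h = (y, z, trans_equiv C y z `` {u})" and A: "s \<in> transformations C w x"
    "t \<in> transformations C x y" "u \<in> transformations C y z"
    and B: "w \<in> Cauchy_sequences C \<mu>" "x \<in> Cauchy_sequences C \<mu>" "y \<in> Cauchy_sequences C \<mu>"
    "z \<in> Cauchy_sequences C \<mu>"
    using f g h by (metis sigma_homE)
  moreover have "tcomp t s \<in> transformations C w y" "tcomp u t \<in> transformations C x z"
    using A B by (auto intro: tcomp_in[OF Cauchy_seq Cauchy_seq Cauchy_seq])
  ultimately show "Comp (sigma C \<mu>) (Comp (sigma C \<mu>) h g) f = Comp (sigma C \<mu>) h (Comp (sigma C \<mu>) g f)"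
    using tcomp_assoc[OF A] by (simp add: sigma_Comp)
qed

lemma normed_category_sigma: "normed_category (sigma C \<mu>) (sigma_norm \<mu>)"
proof -
  interpret S: category "sigma C \<mu>" by (rule category_sigma)
  show ?thesis
  proof
    fix x assume "x \<in> Obj (sigma C \<mu>)"
    then have x: "x \<in> Cauchy_sequences C \<mu>" by (simp add: sigma_simps)
    have "(\<lambda>n. \<mu> (Ident C (omap x n))) \<longlonglongrightarrow> sigma_norm \<mu> (Ident (sigma C \<mu>) x)"
      using sigma_norm_limit[OF ident_in[OF Cauchy_seq[OF x]] x x] by (simp add: sigma_simps)
    moreover have "(\<lambda>n. \<mu> (Ident C (omap x n))) \<longlonglongrightarrow> 0"
      using N1[OF seq_Obj[OF Cauchy_seq[OF x]]] by simp
    ultimately show "sigma_norm \<mu> (Ident (sigma C \<mu>) x) = 0" using LIMSEQ_unique by blast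
  next
    fix g f x y z assume gh: "g \<in> hom (sigma C \<mu>) x y" and fh: "f \<in> hom (sigma C \<mu>) y z"
    obtain s t where e: "g = (x, y, trans_equiv C x y `` {s})" "f = (y, z, trans_equiv C y z `` {t})"
      and A: "s \<in> transformations C x y" "t \<in> transformations C y z"
      and B: "x \<in> Cauchy_sequences C \<mu>" "y \<in> Cauchy_sequences C \<mu>" "z \<in> Cauchy_sequences C \<mu>"
      using gh fh by (metis sigma_homE)
    obtain \<phi> a \<psi> b where st: "s = (\<phi>, a)" "t = (\<psi>, b)" by (metis surj_pair)
    note A' = A[unfolded st]
    have 1: "(\<lambda>n. \<mu> (a n)) \<longlonglongrightarrow> sigma_norm \<mu> g"
      using sigma_norm_limit[OF A'(1) B(1,2)] by (simp add: e st)
    have "(\<lambda>n. \<mu> (b n)) \<longlonglongrightarrow> sigma_norm \<mu> f"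
      using sigma_norm_limit[OF A'(2) B(2,3)] by (simp add: e st)
    then have 2: "(\<lambda>n. \<mu> (b (\<phi> n))) \<longlonglongrightarrow> sigma_norm \<mu> f"
      using filterlim_compose[OF _ transD(2)[OF A'(1)]] by blast
    have "tcomp t s \<in> transformations C x z"
      using A B by (auto intro: tcomp_in[OF Cauchy_seq Cauchy_seq Cauchy_seq])
    then have 3: "(\<lambda>n. \<mu> (b (\<phi> n) \<odot> a n)) \<longlonglongrightarrow> sigma_norm \<mu> (Comp (sigma C \<mu>) f g)"
      using sigma_norm_limit[OF _ B(1,3)] sigma_Comp[OF B A] by (simp add: e st tcomp_def)
    note ab = transD(3)[OF A'(1)] transD(3)[OF A'(2)]
    show "sigma_norm \<mu> (Comp (sigma C \<mu>) f g) \<le> sigma_norm \<mu> f + sigma_norm \<mu> g"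
      using tendsto_le[OF _ tendsto_add[OF 2 1] 3] N2[OF ab] by simp
    show "sigma_norm \<mu> g \<le> sigma_norm \<mu> (Comp (sigma C \<mu>) f g) + sigma_norm \<mu> f"
      using tendsto_le[OF _ tendsto_add[OF 3 2] 1] N3[OF ab] by simp
  qed
qed

end

locale self_contraction = normed_category C \<mu> + contr: contraction C \<mu> C \<mu> F
  for C :: "('o, 'a, 'z) cat_scheme" (structure) and \<mu> :: "'a \<Rightarrow> ennreal"
    and F :: "('o, 'a, 'o, 'a) func"
begin

lemma seq_map_simps:
  "omap (seq_map F x) n = omap F (omap x n)"
  "m \<le> n \<Longrightarrow> bond (seq_map F x) m n = amap F (bond x m n)"
  by (auto simp: seq_map_def Arr_omega)

lemma seq_map_sequences:
  assumes x: "x \<in> sequences C"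
  shows "seq_map F x \<in> sequences C"
proof -
  have "amap (seq_map F x) \<in> extensional (Arr omega)" by (simp add: seq_map_def)
  moreover have "amap F (bond x m n) \<odot> amap F (bond x l m) = amap F (bond x l n)"
    if "l \<le> m" "m \<le> n" for l m n
    using contr.amap_Comp[OF bond_in_hom[OF x that(1)] bond_in_hom[OF x that(2)]]
      bond_Comp[OF x that] by simp
  ultimately show ?thesis
    unfolding sequences_iff[OF category_axioms]
    by (auto simp: seq_map_simps bond_refl[OF x] intro!: contr.omap_in_Obj contr.amap_Ident
      contr.amap_in_hom seq_Obj[OF x] bond_in_hom[OF x])
qed

lemma amap_norm_le:
  assumes "f \<in> hom C x y"
  shows "\<mu> (amap F f) \<le> \<mu> f"
proof -
  obtain r where "r < 1" "\<mu> (amap F f) \<le> r * \<mu> f"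
    using contr.contracts assms by (auto simp: hom_def)
  moreover have "r * \<mu> f \<le> 1 * \<mu> f" using \<open>r < 1\<close> by (intro mult_right_mono) auto
  ultimately show ?thesis by simp
qed

lemma seq_map_Cauchy:
  assumes x: "x \<in> Cauchy_sequences C \<mu>"
  shows "seq_map F x \<in> Cauchy_sequences C \<mu>"
  unfolding Cauchy_sequences_def
proof (clarsimp simp: seq_map_sequences[OF Cauchy_seq[OF x]])
  fix e :: real assume "e > 0"
  then obtain n0 where n0: "\<And>m n. n0 \<le> m \<Longrightarrow> m \<le> n \<Longrightarrow> \<mu> (bond x m n) < ennreal e"
    using CauchyE[OF x] by blast
  have "\<mu> (bond (seq_map F x) m n) < ennreal e" if "n0 < m" "m \<le> n" for m n
    using amap_norm_le[OF bond_in_hom[OF Cauchy_seq[OF x] that(2)]] n0[of m n] that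
    by (simp add: seq_map_simps)
  then show "\<exists>n0. \<forall>m n. n0 < m \<and> m \<le> n \<longrightarrow> \<mu> (bond (seq_map F x) m n) < ennreal e" by blast
qed

lemma map_transformation:
  assumes x: "x \<in> sequences C" and y: "y \<in> sequences C"
    and t: "(\<phi>, f) \<in> transformations C x y"
  shows "(\<phi>, \<lambda>n. amap F (f n)) \<in> transformations C (seq_map F x) (seq_map F y)"
proof (rule transformationsI)
  show "amap F (f n) \<in> hom C (omap (seq_map F x) n) (omap (seq_map F y) (\<phi> n))" for n
    using contr.amap_in_hom[OF transD(3)[OF t]] by (simp add: seq_map_simps)
  fix m n :: nat assume "m < n"
  then have mn: "m \<le> n" and le: "\<phi> m \<le> \<phi> n" using transD(1)[OF t] by (auto simp: monoD)
  show "bond (seq_map F y) (\<phi> m) (\<phi> n) \<odot> amap F (f m) = amap F (f n) \<odot> bond (seq_map F x) m n"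
    using contr.amap_Comp[OF transD(3)[OF t] bond_in_hom[OF y le]]
      contr.amap_Comp[OF bond_in_hom[OF x mn] transD(3)[OF t]] trans_nat[OF t x y mn]
    by (simp add: seq_map_simps mn le)
qed (use transD[OF t] in auto)

lemma map_trans_equiv:
  assumes x: "x \<in> sequences C" and y: "y \<in> sequences C"
    and t: "((\<phi>, f), (\<psi>, g)) \<in> trans_equiv C x y"
  shows "((\<phi>, \<lambda>n. amap F (f n)), (\<psi>, \<lambda>n. amap F (g n))) \<in> trans_equiv C (seq_map F x) (seq_map F y)"
proof (rule trans_equivI)
  note T = trans_equivD(1)[OF t] trans_equivD(2)[OF t]
  show "(\<phi>, \<lambda>n. amap F (f n)) \<in> transformations C (seq_map F x) (seq_map F y)"
    "(\<psi>, \<lambda>n. amap F (g n)) \<in> transformations C (seq_map F x) (seq_map F y)"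
    using map_transformation[OF x y] T by auto
  fix n
  obtain k where k: "\<phi> n \<le> k" "\<psi> n \<le> k" "bond y (\<phi> n) k \<odot> f n = bond y (\<psi> n) k \<odot> g n"
    using trans_equivD(3)[OF t] by blast
  show "\<exists>k. \<phi> n \<le> k \<and> \<psi> n \<le> k \<and>
    bond (seq_map F y) (\<phi> n) k \<odot> amap F (f n) = bond (seq_map F y) (\<psi> n) k \<odot> amap F (g n)"
    using contr.amap_Comp[OF transD(3)[OF T(1)] bond_in_hom[OF y k(1)]]
      contr.amap_Comp[OF transD(3)[OF T(2)] bond_in_hom[OF y k(2)]] k
    by (intro exI[of _ k]) (simp add: seq_map_simps)
qed

lemma extension_arrow:
  assumes x: "x \<in> sequences C" and y: "y \<in> sequences C"
    and t: "(\<phi>, f) \<in> transformations C x y"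
  shows "amap (extension C F) (x, y, trans_equiv C x y `` {(\<phi>, f)}) =
    (seq_map F x, seq_map F y,
       trans_equiv C (seq_map F x) (seq_map F y) `` {(\<phi>, \<lambda>n. amap F (f n))})"
proof -
  let ?h = "\<lambda>s. trans_equiv C (seq_map F x) (seq_map F y) `` {(fst s, \<lambda>n. amap F (snd s n))}"
  note E = trans_equiv_equiv[OF x y]
  note E' = trans_equiv_equiv[OF seq_map_sequences[OF x] seq_map_sequences[OF y]]
  have "congruent (trans_equiv C x y) ?h"
  proof (rule congruentI)
    fix s t assume "(s, t) \<in> trans_equiv C x y"
    then show "?h s = ?h t"
      using equiv_class_eq[OF E' map_trans_equiv[OF x y, of "fst s" "snd s" "fst t" "snd t"]] by simp
  qed
  then show ?thesis
    using UN_equiv_class[OF E _ t, of ?h] by (simp add: extension_def split_beta)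
qed

lemma extension_functor: "cat_functor (sigma C \<mu>) (sigma C \<mu>) (extension C F)"
proof -
  interpret S: category "sigma C \<mu>" by (rule category_sigma)
  have o: "omap (extension C F) x = seq_map F x" for x by (simp add: extension_def)
  show ?thesis
  proof
    fix x assume "x \<in> Obj (sigma C \<mu>)"
    then have x: "x \<in> Cauchy_sequences C \<mu>" by (simp add: sigma_simps)
    show "omap (extension C F) x \<in> Obj (sigma C \<mu>)"
      using seq_map_Cauchy[OF x] by (simp add: o sigma_simps)
    show "amap (extension C F) (Ident (sigma C \<mu>) x) = Ident (sigma C \<mu>) (omap (extension C F) x)"
      using extension_arrow[OF Cauchy_seq[OF x] Cauchy_seq[OF x] ident_in[OF Cauchy_seq[OF x]]]
      by (simp add: o sigma_simps seq_map_simps contr.amap_Ident seq_Obj[OF Cauchy_seq[OF x]])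
  next
    fix h x y assume "h \<in> hom (sigma C \<mu>) x y"
    then obtain t where h: "h = (x, y, trans_equiv C x y `` {t})" and t: "t \<in> transformations C x y"
      and x: "x \<in> Cauchy_sequences C \<mu>" and y: "y \<in> Cauchy_sequences C \<mu>"
      by (rule sigma_homE)
    obtain \<phi> f where e: "t = (\<phi>, f)" by (metis surj_pair)
    note X = Cauchy_seq[OF x] and Y = Cauchy_seq[OF y] and T = t[unfolded e]
    show "amap (extension C F) h \<in> hom (sigma C \<mu>) (omap (extension C F) x) (omap (extension C F) y)"
      unfolding h e o extension_arrow[OF X Y T]
      by (intro sigma_homI map_transformation X Y T seq_map_Cauchy x y)
  next
    fix f g x y z assume fh: "f \<in> hom (sigma C \<mu>) x y" and gh: "g \<in> hom (sigma C \<mu>) y z"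
    obtain s t where e: "f = (x, y, trans_equiv C x y `` {s})" "g = (y, z, trans_equiv C y z `` {t})"
      and A: "s \<in> transformations C x y" "t \<in> transformations C y z"
      and B: "x \<in> Cauchy_sequences C \<mu>" "y \<in> Cauchy_sequences C \<mu>" "z \<in> Cauchy_sequences C \<mu>"
      using fh gh by (metis sigma_homE)
    obtain \<phi> a \<psi> b where st: "s = (\<phi>, a)" "t = (\<psi>, b)" by (metis surj_pair)
    note A' = A[unfolded st]
    note X = Cauchy_seq[OF B(1)] and Y = Cauchy_seq[OF B(2)] and Z = Cauchy_seq[OF B(3)]
    have ts: "tcomp t s \<in> transformations C x z" by (rule tcomp_in[OF X Y Z A])
    then have ts': "(\<lambda>n. \<psi> (\<phi> n), \<lambda>n. b (\<phi> n) \<odot> a n) \<in> transformations C x z"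
      by (simp add: st tcomp_def)
    show "amap (extension C F) (Comp (sigma C \<mu>) g f) =
      Comp (sigma C \<mu>) (amap (extension C F) g) (amap (extension C F) f)"
      unfolding e sigma_Comp[OF B A] unfolding st extension_arrow[OF X Y A'(1)]
        extension_arrow[OF Y Z A'(2)]
        sigma_Comp[OF B[THEN seq_map_Cauchy] map_transformation[OF X Y A'(1)]
          map_transformation[OF Y Z A'(2)]]
      using extension_arrow[OF X Z ts'] contr.amap_Comp[OF transD(3)[OF A'(1)] transD(3)[OF A'(2)]]
      by (simp add: tcomp_def)
  qed
qed

end

end

theory Submission
  imports Defs
begin

text \<open>
  Applying \<open>F\<close> to the orbit \<open>a \<rightarrow> F a \<rightarrow> F\<^sup>2 a \<rightarrow> \<dots>\<close> yields \<open>F a \<rightarrow> F\<^sup>2 a \<rightarrow> F\<^sup>3 a \<rightarrow> \<dots>\<close>, which is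
  the same sequence without its first term (\<open>seq_map_orbit\<close>). So the theorem reduces to two facts.

  First, the orbit is an object of the completion: if \<open>F\<close> contracts by the factor \<open>r < 1\<close>, its
  \<open>i\<close>-th arrow has norm at most \<open>r\<^sup>i * \<mu> f\<close>. These bounds form a convergent geometric series because
  \<open>\<mu> f\<close> is finite, and by (N2) the norm of a composite of consecutive arrows is at most the
  corresponding partial sum of the series (\<open>Cauchy_if_summable\<close>, \<open>orbit_Cauchy\<close>).

  Second, every Cauchy sequence \<open>x\<close> is 0-isomorphic to its tail (\<open>zero_isomorphism_tail\<close>). The
  bonding arrows \<open>x\<^sub>n \<rightarrow> x\<^sub>n\<^sub>+\<^sub>1\<close> form a transformation from \<open>x\<close> to the tail along the identity index map,
  the identities of the \<open>x\<^sub>n\<^sub>+\<^sub>1\<close> form one in the other direction along the successor map, and both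
  composites consist of bonding arrows, which the identification of transformations makes equal to
  the identity. The norm of the isomorphism is the limit of the norms of the bonding arrows
  \<open>x\<^sub>n \<rightarrow> x\<^sub>n\<^sub>+\<^sub>1\<close>, which is \<open>0\<close> by the Cauchy condition.
\<close>

section \<open>Composites of consecutive arrows\<close>

context category
begin

lemma chain_in_hom:
  assumes "\<And>n. x n \<in> Obj C" and "\<And>n. s n \<in> hom C (x n) (x (Suc n))"
  shows "chain C x s m k \<in> hom C (x m) (x (m + k))"
proof (induction k)
  case 0
  show ?case using Ident_in_hom[OF assms(1)] by simp
next
  case (Suc k)
  then show ?case using Comp_in_hom[OF Suc assms(2)] by simp
qed

lemma chain_add:
  assumes "\<And>n. x n \<in> Obj C" and "\<And>n. s n \<in> hom C (x n) (x (Suc n))"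
  shows "chain C x s (m + k) j \<odot> chain C x s m k = chain C x s m (k + j)"
proof (induction j)
  case 0
  show ?case using Comp_Ident_left[OF chain_in_hom[of x s, OF assms]] by simp
next
  case (Suc j)
  have "s (m + k + j) \<in> hom C (x (m + k + j)) (x (Suc (m + k + j)))" by (rule assms(2))
  from Comp_assoc[OF chain_in_hom[of x s, OF assms] chain_in_hom[of x s, OF assms] this] Suc
  show ?case by (simp add: add.assoc)
qed

lemma chain_sequence:
  assumes "\<And>n. x n \<in> Obj C" and "\<And>n. s n \<in> hom C (x n) (x (Suc n))"
  shows "\<lparr>omap = x, amap = restrict (\<lambda>(m, n). chain C x s m (n - m)) (Arr omega)\<rparr> \<in> sequences C"
proof -
  have "chain C x s m (n - m) \<in> hom C (x m) (x n)" if "m \<le> n" for m n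
    using chain_in_hom[of x s m "n - m", OF assms] that by simp
  moreover have "chain C x s m (n - m) \<odot> chain C x s l (m - l) = chain C x s l (n - l)"
    if "l \<le> m" "m \<le> n" for l m n
    using chain_add[of x s l "m - l" "n - m", OF assms] that by simp
  ultimately show ?thesis
    unfolding sequences_iff[OF category_axioms] by (auto simp: Arr_omega assms(1))
qed

end

section \<open>Summable steps give a Cauchy sequence\<close>

context normed_category
begin

lemma chain_norm_le:
  assumes "\<And>n. x n \<in> Obj C" and "\<And>n. s n \<in> hom C (x n) (x (Suc n))"
  shows "\<mu> (chain C x s m k) \<le> (\<Sum>i=m..<m + k. \<mu> (s i))"
proof (induction k)
  case 0
  show ?case by (simp add: N1 assms(1))
next
  case (Suc k)
  have "\<mu> (chain C x s m (Suc k)) \<le> \<mu> (s (m + k)) + \<mu> (chain C x s m k)"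
    using N2[OF chain_in_hom[of x s, OF assms] assms(2)] by simp
  also have "\<dots> \<le> \<mu> (s (m + k)) + (\<Sum>i=m..<m + k. \<mu> (s i))"
    using Suc by (rule add_left_mono)
  finally show ?case by (simp add: add.commute)
qed

text \<open>The Cauchy condition concerns a whole composite of steps; by \<open>chain_norm_le\<close> the tails of a
  convergent series of step bounds control it. The bounds are real numbers because in
  \<open>[0, \<infinity>]\<close> every series converges, so there convergence says nothing about the tails.\<close>

lemma Cauchy_if_summable:
  fixes b :: "nat \<Rightarrow> real"
  assumes x: "\<And>n. x n \<in> Obj C" and s: "\<And>n. s n \<in> hom C (x n) (x (Suc n))"
    and le: "\<And>n. \<mu> (s n) \<le> ennreal (b n)" and nonneg: "\<And>n. 0 \<le> b n" and b: "summable b"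
  shows "\<lparr>omap = x, amap = restrict (\<lambda>(m, n). chain C x s m (n - m)) (Arr omega)\<rparr>
    \<in> Cauchy_sequences C \<mu>"
  unfolding Cauchy_sequences_def
proof (intro CollectI conjI allI impI chain_sequence x s)
  fix e :: real assume "e > 0"
  then obtain n0 where n0: "\<And>m n. n0 \<le> m \<Longrightarrow> norm (sum b {m..<n}) < e"
    using b unfolding summable_Cauchy by blast
  have "\<mu> (chain C x s m (n - m)) < ennreal e" if "n0 < m" "m \<le> n" for m n
  proof -
    have "\<mu> (chain C x s m (n - m)) \<le> (\<Sum>i=m..<n. \<mu> (s i))"
      using chain_norm_le[of x s m "n - m", OF x s] that by simp
    also have "\<dots> \<le> (\<Sum>i=m..<n. ennreal (b i))"
      by (intro sum_mono le)
    also have "\<dots> = ennreal (sum b {m..<n})"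
      by (simp add: nonneg)
    also have "\<dots> < ennreal e"
      using n0[of m n] that \<open>e > 0\<close> by (intro ennreal_lessI) auto
    finally show ?thesis .
  qed
  then show "\<exists>n0. \<forall>m n. n0 < m \<and> m \<le> n \<longrightarrow>
    \<mu> (bond \<lparr>omap = x, amap = restrict (\<lambda>(m, n). chain C x s m (n - m)) (Arr omega)\<rparr> m n)
      < ennreal e"
    by (intro exI[of _ n0]) (auto simp: Arr_omega)
qed

end

section \<open>A Cauchy sequence is 0-isomorphic to its tail\<close>

definition tail_seq :: "('o, 'a) seqn \<Rightarrow> ('o, 'a) seqn" where
  "tail_seq x = \<lparr>omap = (\<lambda>n. omap x (Suc n)),
                 amap = restrict (\<lambda>(m, n). bond x (Suc m) (Suc n)) (Arr omega)\<rparr>"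

lemma tail_seq_simps:
  "omap (tail_seq x) n = omap x (Suc n)"
  "m \<le> n \<Longrightarrow> bond (tail_seq x) m n = bond x (Suc m) (Suc n)"
  by (auto simp: tail_seq_def Arr_omega)

context category
begin

lemma tail_seq_sequences:
  assumes x: "x \<in> sequences C"
  shows "tail_seq x \<in> sequences C"
proof -
  have "amap (tail_seq x) \<in> extensional (Arr omega)" by (simp add: tail_seq_def)
  then show ?thesis
    unfolding sequences_iff[OF category_axioms]
    by (auto simp: tail_seq_simps bond_refl[OF x] bond_Comp[OF x]
      intro!: seq_Obj[OF x] bond_in_hom[OF x])
qed

lemma bond_to_tail:
  assumes x: "x \<in> sequences C"
  shows "(\<lambda>n. n, \<lambda>n. bond x n (Suc n)) \<in> transformations C x (tail_seq x)"
  by (rule transformationsI)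
    (auto simp: mono_def filterlim_ident tail_seq_simps bond_Comp[OF x] intro: bond_in_hom[OF x])

lemma ident_from_tail:
  assumes x: "x \<in> sequences C"
  shows "(Suc, \<lambda>n. Ident C (omap x (Suc n))) \<in> transformations C (tail_seq x) x"
proof (rule transformationsI)
  fix m n :: nat assume "m < n"
  then have "bond x (Suc m) (Suc n) \<in> hom C (omap x (Suc m)) (omap x (Suc n))"
    using bond_in_hom[OF x] by simp
  then show "bond x (Suc m) (Suc n) \<odot> Ident C (omap x (Suc m)) =
      Ident C (omap x (Suc n)) \<odot> bond (tail_seq x) m n"
    using \<open>m < n\<close> by (simp add: tail_seq_simps Comp_Ident_left Comp_Ident_right)
qed (auto simp: mono_def filterlim_Suc tail_seq_simps intro: Ident_in_hom seq_Obj[OF x])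

text \<open>Moving one step along the sequence is identified with staying in place, because the two
  transformations agree once the identity is composed with the same bonding arrow. Both composites
  of the isomorphism with its inverse have this form.\<close>

lemma bond_equiv_ident:
  assumes x: "x \<in> sequences C"
  shows "((Suc, \<lambda>n. bond x n (Suc n)), (\<lambda>n. n, \<lambda>n. Ident C (omap x n))) \<in> trans_equiv C x x"
proof (rule trans_equivI)
  show "(Suc, \<lambda>n. bond x n (Suc n)) \<in> transformations C x x"
    by (rule transformationsI)
      (auto simp: mono_def filterlim_Suc bond_Comp[OF x] intro: bond_in_hom[OF x])
  show "(\<lambda>n. n, \<lambda>n. Ident C (omap x n)) \<in> transformations C x x"
    by (rule ident_in[OF x])
  fix n
  have b: "bond x n (Suc n) \<in> hom C (omap x n) (omap x (Suc n))"
    using bond_in_hom[OF x] by simp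
  show "\<exists>k. Suc n \<le> k \<and> n \<le> k \<and>
    bond x (Suc n) k \<odot> bond x n (Suc n) = bond x n k \<odot> Ident C (omap x n)"
    by (intro exI[of _ "Suc n"]) (simp add: bond_Comp[OF x] Comp_Ident_right[OF b])
qed

end

context normed_category
begin

lemma tail_seq_Cauchy:
  assumes x: "x \<in> Cauchy_sequences C \<mu>"
  shows "tail_seq x \<in> Cauchy_sequences C \<mu>"
  unfolding Cauchy_sequences_def
proof (intro CollectI conjI allI impI tail_seq_sequences Cauchy_seq[OF x])
  fix e :: real assume "e > 0"
  then obtain n0 where "\<And>m n. n0 \<le> m \<Longrightarrow> m \<le> n \<Longrightarrow> \<mu> (bond x m n) < ennreal e"
    using CauchyE[OF x] by blast
  then show "\<exists>n0. \<forall>m n. n0 < m \<and> m \<le> n \<longrightarrow> \<mu> (bond (tail_seq x) m n) < ennreal e"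
    by (intro exI[of _ n0]) (auto simp: tail_seq_simps)
qed

lemma bond_norm_tendsto_zero:
  assumes x: "x \<in> Cauchy_sequences C \<mu>"
  shows "(\<lambda>n. \<mu> (bond x n (Suc n))) \<longlonglongrightarrow> 0"
proof (rule order_tendstoI)
  fix e :: ennreal assume "0 < e"
  then obtain d where d: "0 < ennreal d" "ennreal d < e"
    using dense[of 0 e] by (metis ennreal_cases not_less top_greatest)
  obtain n0 where "\<And>m n. n0 \<le> m \<Longrightarrow> m \<le> n \<Longrightarrow> \<mu> (bond x m n) < ennreal d"
    using CauchyE[OF x, of d] d(1) by (auto simp: ennreal_less_zero_iff)
  then have "\<mu> (bond x n (Suc n)) < e" if "n0 \<le> n" for n
    using that d(2) by (metis le_SucI order.refl order.strict_trans)
  then show "eventually (\<lambda>n. \<mu> (bond x n (Suc n)) < e) sequentially"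
    by (auto simp: eventually_sequentially)
qed simp

text \<open>An inverse cannot be sought along the identity index map, since there need be no arrow
  \<open>x\<^sub>n\<^sub>+\<^sub>1 \<rightarrow> x\<^sub>n\<close>; reindexing by the successor makes identities available instead.\<close>

lemma zero_isomorphism_tail:
  assumes x: "x \<in> Cauchy_sequences C \<mu>"
  obtains h where "h \<in> hom (sigma C \<mu>) x (tail_seq x)"
    "zero_isomorphism (sigma C \<mu>) (sigma_norm \<mu>) h"
proof
  let ?y = "tail_seq x"
  let ?s = "(\<lambda>n. n, \<lambda>n. bond x n (Suc n))" and ?t = "(Suc, \<lambda>n. Ident C (omap x (Suc n)))"
  let ?h = "(x, ?y, trans_equiv C x ?y `` {?s})" and ?g = "(?y, x, trans_equiv C ?y x `` {?t})"
  note X = Cauchy_seq[OF x] and y = tail_seq_Cauchy[OF x]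
  note Y = Cauchy_seq[OF y] and s = bond_to_tail[OF X] and t = ident_from_tail[OF X]
  have b: "bond x n (Suc n) \<in> hom C (omap x n) (omap x (Suc n))" for n
    using bond_in_hom[OF X] by simp
  show h: "?h \<in> hom (sigma C \<mu>) x ?y" by (rule sigma_homI[OF s x y])
  have g: "?g \<in> hom (sigma C \<mu>) ?y x" by (rule sigma_homI[OF t y x])
  have "tcomp ?t ?s = (Suc, \<lambda>n. bond x n (Suc n))"
    by (simp add: tcomp_def Comp_Ident_left[OF b])
  then have gh: "Comp (sigma C \<mu>) ?g ?h = Ident (sigma C \<mu>) x"
    using equiv_class_eq[OF trans_equiv_equiv[OF X X] bond_equiv_ident[OF X]]
    by (simp add: sigma_Comp[OF x y x s t] sigma_simps)
  have "tcomp ?s ?t = (Suc, \<lambda>n. bond ?y n (Suc n))"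
    by (simp add: tcomp_def tail_seq_simps Comp_Ident_right[OF b])
  then have hg: "Comp (sigma C \<mu>) ?h ?g = Ident (sigma C \<mu>) ?y"
    using equiv_class_eq[OF trans_equiv_equiv[OF Y Y] bond_equiv_ident[OF Y]]
    by (simp add: sigma_Comp[OF y x y t s] sigma_simps)
  have "sigma_norm \<mu> ?h = 0"
    using sigma_norm_limit[OF s x y] bond_norm_tendsto_zero[OF x] LIMSEQ_unique by blast
  then show "zero_isomorphism (sigma C \<mu>) (sigma_norm \<mu>) ?h"
    using h g gh hg unfolding zero_isomorphism_def isomorphism_def hom_def by auto
qed

end

section \<open>The orbit of an arrow under a contraction\<close>

context self_contraction
begin

lemma iterate_in_hom:
  assumes "f \<in> hom C a (omap F a)"
  shows "(amap F ^^ n) f \<in> hom C ((omap F ^^ n) a) ((omap F ^^ Suc n) a)"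
  by (induction n) (use assms contr.amap_in_hom in auto)

lemma iterate_Obj:
  assumes "a \<in> Obj C"
  shows "(omap F ^^ n) a \<in> Obj C"
  by (induction n) (use assms contr.omap_in_Obj in auto)

lemma iterate_norm_le:
  assumes r: "\<And>g. g \<in> Arr C \<Longrightarrow> \<mu> (amap F g) \<le> r * \<mu> g" and f: "f \<in> hom C a (omap F a)"
  shows "\<mu> ((amap F ^^ n) f) \<le> r ^ n * \<mu> f"
proof (induction n)
  case (Suc n)
  have "\<mu> ((amap F ^^ Suc n) f) \<le> r * \<mu> ((amap F ^^ n) f)"
    using r iterate_in_hom[OF f, of n] by (simp add: hom_def)
  also have "\<dots> \<le> r * (r ^ n * \<mu> f)"
    using Suc by (rule mult_left_mono) simp
  finally show ?case by (simp add: mult.assoc)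
qed simp

lemma orbit_Cauchy:
  assumes f: "f \<in> hom C a (omap F a)" and fin: "\<mu> f < \<infinity>"
  shows "orbit C F a f \<in> Cauchy_sequences C \<mu>"
proof -
  obtain r where r: "r < 1" "\<And>g. g \<in> Arr C \<Longrightarrow> \<mu> (amap F g) \<le> r * \<mu> g"
    using contr.contracts by blast
  \<comment> \<open>Both the factor and the norm of \<open>f\<close> are finite, so the geometric series can be taken over the
    reals.\<close>
  define q where "q = enn2real r"
  define c where "c = enn2real (\<mu> f)"
  have rq: "r = ennreal q" and q: "0 \<le> q"
    using order.strict_trans[OF r(1) ennreal_one_less_top] by (simp_all add: q_def)
  have c: "\<mu> f = ennreal c" "0 \<le> c"
    using fin by (auto simp: c_def)
  have "q < 1" using r(1) by (simp add: rq q ennreal_less_one_iff)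
  show ?thesis unfolding orbit_def
  proof (rule Cauchy_if_summable)
    show "\<mu> ((amap F ^^ n) f) \<le> ennreal (q ^ n * c)" for n
      using iterate_norm_le[OF r(2) f, of n] by (simp add: rq c q ennreal_power ennreal_mult)
    show "summable (\<lambda>n. q ^ n * c)"
      using q \<open>q < 1\<close> by (intro summable_mult2 summable_geometric) simp
  qed (use iterate_Obj[OF hom_Obj(1)[OF f]] iterate_in_hom[OF f] q c in auto)
qed

text \<open>Functoriality shifts every bonding arrow of the orbit by one step, because \<open>F\<close> takes each step
  of the orbit to the next one.\<close>

lemma amap_chain:
  assumes f: "f \<in> hom C a (omap F a)"
  shows "amap F (chain C (\<lambda>i. (omap F ^^ i) a) (\<lambda>i. (amap F ^^ i) f) m k) =
    chain C (\<lambda>i. (omap F ^^ i) a) (\<lambda>i. (amap F ^^ i) f) (Suc m) k"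
proof (induction k)
  case 0
  show ?case using contr.amap_Ident[OF iterate_Obj[OF hom_Obj(1)[OF f]]] by simp
next
  case (Suc k)
  have "chain C (\<lambda>i. (omap F ^^ i) a) (\<lambda>i. (amap F ^^ i) f) m k
      \<in> hom C ((omap F ^^ m) a) ((omap F ^^ (m + k)) a)"
    by (intro chain_in_hom iterate_Obj[OF hom_Obj(1)[OF f]] iterate_in_hom[OF f])
  from contr.amap_Comp[OF this iterate_in_hom[OF f]] Suc show ?case by simp
qed

lemma seq_map_orbit:
  assumes f: "f \<in> hom C a (omap F a)"
  shows "seq_map F (orbit C F a f) = tail_seq (orbit C F a f)"
  unfolding seq_map_def tail_seq_def
  by (auto simp: orbit_def Arr_omega amap_chain[OF f] intro!: restrict_ext)

end

theorem theorem4p1: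
  fixes K :: "('o, 'a) cat" and \<mu> :: "'a \<Rightarrow> ennreal"
    and F :: "('o, 'a, 'o, 'a) func" and a :: 'o and f :: 'a
  assumes "normed_category K \<mu>"
    and "contraction K \<mu> K \<mu> F"
    and "f \<in> hom K a (omap F a)"
    and "\<mu> f < \<infinity>"
  shows "fixed_point (sigma K \<mu>) (sigma_norm \<mu>) (extension K F) (orbit K F a f)"
proof -
  interpret self_contraction K \<mu> F
    using assms(1,2) by (simp add: self_contraction_def)
  have X: "orbit K F a f \<in> Cauchy_sequences K \<mu>"
    by (rule orbit_Cauchy[OF assms(3,4)])
  obtain h where "h \<in> hom (sigma K \<mu>) (orbit K F a f) (tail_seq (orbit K F a f))"
    "zero_isomorphism (sigma K \<mu>) (sigma_norm \<mu>) h"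
    by (rule zero_isomorphism_tail[OF X])
  then show ?thesis
    using X seq_map_orbit[OF assms(3)] by (auto simp: fixed_point_def extension_def sigma_simps)
qed

end
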